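(* Let $f:\mathcal{M}\to\mathbb{R}$ be $\mathcal{C}^1$-smooth and let $L>0$. Suppose: (1) (descent condition) $f(\mathcal{R}_x(\eta))\le f(x)+\langle \mathrm{grad} f(x),\eta\rangle_x+\frac{L}{2}\|\eta\|^2$ for all $x\in\mathcal{M}$, $\eta\in T_x\mathcal{M}$; (2) (Lipschitz gradient, $f\in\mathcal{C}^{1,L}$) $\|\mathcal{T}_y^x\,\mathrm{grad} f(y)-\mathrm{grad} f(x)\|\le L\|\eta\|$ for all $x\in\mathcal{M}$, $\eta\in T_x\mathcal{M}$, where $y=\mathcal{R}_x(\eta)$. Let $\{t_k\}_{k\ge1}\subset(0,\infty)$ and $\{\rho_k\}_{k\ge1}\subset(0,\infty)$ satisfy $$\sum_{k=1}^\infty t_k=\infty,\quad t_k\downarrow0,\quad\sum_{k=1}^\infty t_k\rho_k<\infty,\quad\limsup_{k\to\infty}\rho_k<\frac{2}{L}.$$ Let $\{x_k\}_{k\ge1}\subset\mathcal{M}$ be a sequence generated by Riemannian sharpness-aware minimization (RSAM): $x_1\in\mathcal{M}$ and, for $k=1,2,\ldots$, $$x_k^{adv}=\mathcal{R}_{x_k}\Big(\rho_k\frac{\mathrm{grad} f(x_k)}{\|\mathrm{grad} f(x_k)\|}\Big),\qquad x_{k+1}=\mathcal{R}_{x_k}\big(-t_k\,\mathcal{T}_{x_k^{adv}}^{x_k}\mathrm{grad} f(x_k^{adv})\big),$$ where $\mathrm{grad} f(x_k)\neq0$ for all $k$ (so that the iteration is well defined), and suppose $\inf_kf(x_k)>-\infty$.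 Then: (i) $\mathrm{grad} f(x_k)\to0$, and thus every accumulation point of $\{x_k\}$ is a stationary point of $f$. (ii) If $\bar x$ is an accumulation point of $\{x_k\}$, then $f(x_k)\to f(\bar x)$.
   Context: $\mathcal{M}\subset\mathbb{R}^n$ is a Riemannian submanifold embedded in $\mathbb{R}^n$, with inner product $\langle\cdot,\cdot\rangle_x$ on $T_x\mathcal{M}$ varying smoothly in $x$ and induced norm $\|\cdot\|$ on tangent vectors. The Riemannian gradient $\mathrm{grad} f(x)\in T_x\mathcal{M}$ is the unique tangent vector with $\langle\mathrm{grad} f(x),\xi\rangle_x=Df(x)[\xi]$ for all $\xi\in T_x\mathcal{M}$; $\bar x$ is stationary for $f$ if $\mathrm{grad} f(\bar x)=0$. $\mathcal{R}:T\mathcal{M}\to\mathcal{M}$ is a retraction: a smooth map whose restriction $\mathcal{R}_x$ to $T_x\mathcal{M}$ satisfies $\mathcal{R}_x(0_x)=x$ and $D\mathcal{R}_x(0_x)=\mathrm{id}_{T_x\mathcal{M}}$. $\mathcal{T}$ is a vector transport: a smooth map $(\eta_x,\xi_x)\mapsto\mathcal{T}_{\eta_x}(\xi_x)\in T_{\mathcal{R}_x(\eta_x)}\mathcal{M}$, linear in $\xi_x$, with $\mathcal{T}_{0_x}\xi_x=\xi_x$; it is isometric: $\langle\mathcal{T}_{\eta_x}\xi_x,\mathcal{T}_{\eta_x}\zeta_x\rangle_{\mathcal{R}_x(\eta_x)}=\langle\xi_x,\zeta_x\rangle_x$. For $y=\mathcal{R}_x(\eta)$, $\mathcal{T}_y^x:T_y\mathcal{M}\to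 T_x\mathcal{M}$ denotes $\mathcal{T}_\eta^{-1}$; in particular $\mathcal{T}_{x_k^{adv}}^{x_k}=\mathcal{T}_{\eta}^{-1}$ with $\eta=\rho_k\,\mathrm{grad} f(x_k)/\|\mathrm{grad} f(x_k)\|$. $t_k\downarrow0$ means that $t_k$ decreases to $0$. Accumulation points are taken in $\mathcal{M}$. *)

theory Defs
  imports "HOL-Analysis.Analysis"
begin

text \<open>
  Smoothness is \<open>C\<^sup>\<infinity>\<close>. On an open set it is expressed through iterated Frechet derivatives in
  fixed directions, which in finite dimension is the usual notion.
\<close>

primrec C_diff_open ::
  "nat \<Rightarrow> 'a::euclidean_space set \<Rightarrow> ('a \<Rightarrow> 'b::real_normed_vector) \<Rightarrow> bool" where
  "C_diff_open 0 U f \<longleftrightarrow> continuous_on U f"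
| "C_diff_open (Suc k) U f \<longleftrightarrow>
     (\<forall>x\<in>U. f differentiable (at x)) \<and>
     (\<forall>v. C_diff_open k U (\<lambda>x. frechet_derivative f (at x) v))"

definition smooth_open ::
  "'a::euclidean_space set \<Rightarrow> ('a \<Rightarrow> 'b::real_normed_vector) \<Rightarrow> bool" where
  "smooth_open U f \<longleftrightarrow> (\<forall>k. C_diff_open k U f)"

text \<open>
  A map on a subset of a Euclidean space (in practice an embedded submanifold, its tangent bundle,
  or the Whitney sum of the tangent bundle with itself) is \<open>C\<^sup>k\<close>, or smooth, if near each point of
  the set it agrees with a map of that class on an open subset of the ambient space.
\<close>

definition C_diff_on ::
  "nat \<Rightarrow> 'a::euclidean_space set \<Rightarrow> ('a \<Rightarrow> 'b::real_normed_vector) \<Rightarrow> bool" where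
  "C_diff_on k A f \<longleftrightarrow>
     (\<forall>x\<in>A. \<exists>U F. open U \<and> x \<in> U \<and> C_diff_open k U F \<and> (\<forall>y\<in>A \<inter> U. F y = f y))"

definition smooth_on ::
  "'a::euclidean_space set \<Rightarrow> ('a \<Rightarrow> 'b::real_normed_vector) \<Rightarrow> bool" where
  "smooth_on A f \<longleftrightarrow>
     (\<forall>x\<in>A. \<exists>U F. open U \<and> x \<in> U \<and> smooth_open U F \<and> (\<forall>y\<in>A \<inter> U. F y = f y))"

text \<open>Slice charts: near each of its points \<open>M\<close> is straightened to a \<open>d\<close>-dimensional subspace.\<close>

definition embedded_submanifold :: "nat \<Rightarrow> 'a::euclidean_space set \<Rightarrow> bool" where
  "embedded_submanifold d M \<longleftrightarrow>
     (\<forall>x\<in>M. \<exists>U V \<phi> \<psi> S. open U \<and> x \<in> U \<and> open V \<and>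
        homeomorphism U V \<phi> \<psi> \<and> smooth_open U \<phi> \<and> smooth_open V \<psi> \<and>
        subspace (S :: 'a set) \<and> dim S = d \<and> \<phi> ` (M \<inter> U) = S \<inter> V)"

definition curve_through ::
  "'a::euclidean_space set \<Rightarrow> 'a \<Rightarrow> 'a \<Rightarrow> (real \<Rightarrow> 'a) \<Rightarrow> bool" where
  "curve_through M x v \<gamma> \<longleftrightarrow>
     (\<exists>e>0. smooth_open {-e<..<e} \<gamma> \<and> \<gamma> ` {-e<..<e} \<subseteq> M) \<and>
     \<gamma> 0 = x \<and> (\<gamma> has_vector_derivative v) (at 0)"

definition tangent_space :: "'a::euclidean_space set \<Rightarrow> 'a \<Rightarrow> 'a set" where
  "tangent_space M x = {v. \<exists>\<gamma>. curve_through M x v \<gamma>}"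

definition tangent_bundle :: "'a::euclidean_space set \<Rightarrow> ('a \<times> 'a) set" where
  "tangent_bundle M = {(x, v). x \<in> M \<and> v \<in> tangent_space M x}"

definition tangent_whitney_sum :: "'a::euclidean_space set \<Rightarrow> ('a \<times> 'a \<times> 'a) set" where
  "tangent_whitney_sum M =
     {(x, v, w). x \<in> M \<and> v \<in> tangent_space M x \<and> w \<in> tangent_space M x}"

text \<open>\<open>g x v w\<close> is the inner product of \<open>v\<close> and \<open>w\<close> in the tangent space at \<open>x\<close>. It need not be
  the restriction of the ambient inner product.\<close>

definition riemannian_metric ::
  "'a::euclidean_space set \<Rightarrow> ('a \<Rightarrow> 'a \<Rightarrow> 'a \<Rightarrow> real) \<Rightarrow> bool" where
  "riemannian_metric M g \<longleftrightarrow>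
     (\<forall>x\<in>M. \<forall>u\<in>tangent_space M x. \<forall>v\<in>tangent_space M x.
        g x u v = g x v u \<and>
        (\<forall>w\<in>tangent_space M x. \<forall>a b. g x (a *\<^sub>R u + b *\<^sub>R v) w = a * g x u w + b * g x v w)) \<and>
     (\<forall>x\<in>M. \<forall>v\<in>tangent_space M x. v \<noteq> 0 \<longrightarrow> g x v v > 0) \<and>
     smooth_on (tangent_whitney_sum M) (\<lambda>(x, v, w). g x v w)"

definition metric_norm :: "('a \<Rightarrow> 'a \<Rightarrow> 'a \<Rightarrow> real) \<Rightarrow> 'a \<Rightarrow> 'a \<Rightarrow> real" where
  "metric_norm g x v = sqrt (g x v v)"

text \<open>The differential \<open>Df(x)[v]\<close> of a function on \<open>M\<close>, taken along curves in \<open>M\<close>.\<close>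

definition differential ::
  "'a::euclidean_space set \<Rightarrow> ('a \<Rightarrow> real) \<Rightarrow> 'a \<Rightarrow> 'a \<Rightarrow> real" where
  "differential M f x v =
     (THE c. \<forall>\<gamma>. curve_through M x v \<gamma> \<longrightarrow> ((f \<circ> \<gamma>) has_real_derivative c) (at 0))"

definition grad ::
  "'a::euclidean_space set \<Rightarrow> ('a \<Rightarrow> 'a \<Rightarrow> 'a \<Rightarrow> real) \<Rightarrow> ('a \<Rightarrow> real) \<Rightarrow> 'a \<Rightarrow> 'a" where
  "grad M g f x =
     (THE \<xi>. \<xi> \<in> tangent_space M x \<and> (\<forall>v\<in>tangent_space M x. g x \<xi> v = differential M f x v))"

definition stationary_point ::
  "'a::euclidean_space set \<Rightarrow> ('a \<Rightarrow> 'a \<Rightarrow> 'a \<Rightarrow> real) \<Rightarrow> ('a \<Rightarrow> real) \<Rightarrow> 'a \<Rightarrow> bool" where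
  "stationary_point M g f x \<longleftrightarrow> x \<in> M \<and> grad M g f x = 0"

text \<open>Retractions in the sense of optimization on manifolds, unrelated to the topological
  \<^const>\<open>retraction\<close>; \<open>R x v\<close> stands for \<open>R\<^sub>x(v)\<close>. The derivative at the origin is taken within
  the linear space \<open>tangent_space M x\<close>, so only its values on tangent vectors are constrained.\<close>

definition manifold_retraction ::
  "'a::euclidean_space set \<Rightarrow> ('a \<Rightarrow> 'a \<Rightarrow> 'a) \<Rightarrow> bool" where
  "manifold_retraction M R \<longleftrightarrow>
     (\<forall>x\<in>M. \<forall>v\<in>tangent_space M x. R x v \<in> M) \<and>
     smooth_on (tangent_bundle M) (\<lambda>(x, v). R x v) \<and>
     (\<forall>x\<in>M. R x 0 = x \<and> (R x has_derivative (\<lambda>v. v)) (at 0 within tangent_space M x))"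

text \<open>\<open>T x \<eta> \<xi>\<close> is the transport of \<open>\<xi>\<close> along \<open>\<eta>\<close>, both tangent at \<open>x\<close>.\<close>

definition vector_transport ::
  "'a::euclidean_space set \<Rightarrow> ('a \<Rightarrow> 'a \<Rightarrow> 'a) \<Rightarrow> ('a \<Rightarrow> 'a \<Rightarrow> 'a \<Rightarrow> 'a) \<Rightarrow> bool" where
  "vector_transport M R T \<longleftrightarrow>
     (\<forall>x\<in>M. \<forall>\<eta>\<in>tangent_space M x. \<forall>\<xi>\<in>tangent_space M x.
        T x \<eta> \<xi> \<in> tangent_space M (R x \<eta>) \<and>
        (\<forall>\<zeta>\<in>tangent_space M x. \<forall>a b.
           T x \<eta> (a *\<^sub>R \<xi> + b *\<^sub>R \<zeta>) = a *\<^sub>R T x \<eta> \<xi> + b *\<^sub>R T x \<eta> \<zeta>)) \<and>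
     (\<forall>x\<in>M. \<forall>\<xi>\<in>tangent_space M x. T x 0 \<xi> = \<xi>) \<and>
     smooth_on (tangent_whitney_sum M) (\<lambda>(x, \<eta>, \<xi>). T x \<eta> \<xi>)"

definition isometric_transport ::
  "'a::euclidean_space set \<Rightarrow> ('a \<Rightarrow> 'a \<Rightarrow> 'a \<Rightarrow> real) \<Rightarrow> ('a \<Rightarrow> 'a \<Rightarrow> 'a) \<Rightarrow>
     ('a \<Rightarrow> 'a \<Rightarrow> 'a \<Rightarrow> 'a) \<Rightarrow> bool" where
  "isometric_transport M g R T \<longleftrightarrow>
     (\<forall>x\<in>M. \<forall>\<eta>\<in>tangent_space M x. \<forall>\<xi>\<in>tangent_space M x. \<forall>\<zeta>\<in>tangent_space M x.
        g (R x \<eta>) (T x \<eta> \<xi>) (T x \<eta> \<zeta>) = g x \<xi> \<zeta>)"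

text \<open>The inverse of \<open>T x \<eta>\<close> from the tangent space at \<open>R x \<eta>\<close> to the one at \<open>x\<close>. It is indexed by
  \<open>\<eta>\<close> and not by \<open>R x \<eta>\<close>, because \<open>R x\<close> need not be injective. An isometric transport is bijective
  between the two tangent spaces, as these have the same dimension.\<close>

definition inverse_transport ::
  "'a::euclidean_space set \<Rightarrow> ('a \<Rightarrow> 'a \<Rightarrow> 'a \<Rightarrow> 'a) \<Rightarrow> 'a \<Rightarrow> 'a \<Rightarrow> 'a \<Rightarrow> 'a" where
  "inverse_transport M T x \<eta> = inv_into (tangent_space M x) (T x \<eta>)"

definition rsam_direction ::
  "'a::euclidean_space set \<Rightarrow> ('a \<Rightarrow> 'a \<Rightarrow> 'a \<Rightarrow> real) \<Rightarrow> ('a \<Rightarrow> real) \<Rightarrow> real \<Rightarrow> 'a \<Rightarrow> 'a" where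
  "rsam_direction M g f \<rho> x = (\<rho> / metric_norm g x (grad M g f x)) *\<^sub>R grad M g f x"

definition rsam_sequence ::
  "'a::euclidean_space set \<Rightarrow> ('a \<Rightarrow> 'a \<Rightarrow> 'a \<Rightarrow> real) \<Rightarrow> ('a \<Rightarrow> 'a \<Rightarrow> 'a) \<Rightarrow>
     ('a \<Rightarrow> 'a \<Rightarrow> 'a \<Rightarrow> 'a) \<Rightarrow> ('a \<Rightarrow> real) \<Rightarrow> (nat \<Rightarrow> real) \<Rightarrow> (nat \<Rightarrow> real) \<Rightarrow>
     (nat \<Rightarrow> 'a) \<Rightarrow> bool" where
  "rsam_sequence M g R T f t \<rho> x \<longleftrightarrow>
     x 1 \<in> M \<and>
     (\<forall>k\<ge>1. let \<eta> = rsam_direction M g f (\<rho> k) (x k);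
                 x_adv = R (x k) \<eta>
             in x (Suc k) =
                  R (x k) (- t k *\<^sub>R inverse_transport M T (x k) \<eta> (grad M g f x_adv)))"

text \<open>Subsequential limits in \<open>M\<close>. The subspace topology of \<open>M\<close> is its manifold topology.\<close>

definition accumulation_point ::
  "'a::euclidean_space set \<Rightarrow> (nat \<Rightarrow> 'a) \<Rightarrow> 'a \<Rightarrow> bool" where
  "accumulation_point M x p \<longleftrightarrow> p \<in> M \<and> (\<exists>r. strict_mono r \<and> (x \<circ> r) \<longlonglongrightarrow> p)"

end

theory Submission
  imports Defs
begin

text \<open>
  Write \<open>a\<^sub>k\<close> for the norm of \<open>grad f(x\<^sub>k)\<close>. The perturbed gradient, transported back to \<open>x\<^sub>k\<close>, is within
  \<open>L \<rho>\<^sub>k\<close> of the gradient. Splitting \<open>2 \<rho>\<^sub>k a\<^sub>k \<le> \<rho>\<^sub>k a\<^sub>k\<^sup>2 + \<rho>\<^sub>k\<close> in the descent inequality leaves, since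
  \<open>limsup \<rho>\<^sub>k < 2 / L\<close>, a decrease of \<open>c t\<^sub>k a\<^sub>k\<^sup>2\<close> up to the summable error \<open>C t\<^sub>k \<rho>\<^sub>k\<close>; so \<open>f(x\<^sub>k)\<close>
  converges and \<open>t\<^sub>k a\<^sub>k\<^sup>2\<close> is summable. Because the transport is isometric, the Lipschitz condition
  makes \<open>a\<^sub>k\<^sup>2\<close> increase by at most a summable amount as well, hence it converges, and its limit is
  \<open>0\<close> as \<open>t\<^sub>k\<close> is not summable.
\<close>

section \<open>Tangent spaces of embedded submanifolds\<close>

text \<open>On an open set equal functions have equal Frechet derivatives, so the induction passes
  to every directional derivative. This allows a \<open>frechet_derivative\<close> to be replaced by
  a computed formula for it.\<close>

lemma C_diff_open_cong:
  assumes "open U" "C_diff_open k U F" "\<And>y. y \<in> U \<Longrightarrow> F y = G y"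
  shows "C_diff_open k U G"
  using assms(2,3)
proof (induction k arbitrary: F G)
  case 0
  then show ?case by (simp cong: continuous_on_cong)
next
  case (Suc k)
  have deriv: "(G has_derivative frechet_derivative F (at y)) (at y)" if "y \<in> U" for y
  proof (rule has_derivative_transform_within_open[OF _ \<open>open U\<close> that])
    show "(F has_derivative frechet_derivative F (at y)) (at y)"
      using Suc.prems(1) that by (simp add: frechet_derivative_works)
  qed (use Suc.prems in auto)
  have eq: "frechet_derivative F (at y) = frechet_derivative G (at y)" if "y \<in> U" for y
    using frechet_derivative_at[OF deriv[OF that]] .
  have "C_diff_open k U (\<lambda>y. frechet_derivative G (at y) v)" for v
    by (rule Suc.IH[of "\<lambda>y. frechet_derivative F (at y) v"]) (use Suc.prems eq in auto)
  then show ?case using deriv by (auto simp: differentiable_def)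
qed

text \<open>The factor \<open>c\<close> closes the induction: the derivative in direction
  \<open>v\<close> is \<open>c * v\<close> times the derivative of \<open>G\<close> along
  \<open>w\<close>, evaluated on the line, hence again of the same form. This gives smoothness of
  the curves that realise tangent vectors.\<close>

lemma C_diff_open_line:
  fixes G :: "'a::euclidean_space \<Rightarrow> 'b::real_normed_vector"
  assumes "C_diff_open k V G" "open I" "\<And>s. s \<in> I \<Longrightarrow> a + s *\<^sub>R w \<in> V"
  shows "C_diff_open k I (\<lambda>s::real. c *\<^sub>R G (a + s *\<^sub>R w))"
  using assms(1)
proof (induction k arbitrary: G c)
  case 0
  have "continuous_on I (\<lambda>s. G (a + s *\<^sub>R w))"
    by (rule continuous_on_compose2[of V G]) (use 0 assms(3) in \<open>auto intro!: continuous_intros\<close>)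
  then show ?case by (auto intro!: continuous_intros)
next
  case (Suc k)
  have deriv: "((\<lambda>s. c *\<^sub>R G (a + s *\<^sub>R w)) has_derivative
      (\<lambda>h. (c * h) *\<^sub>R frechet_derivative G (at (a + s *\<^sub>R w)) w)) (at s)" if "s \<in> I" for s
  proof -
    let ?G = "frechet_derivative G (at (a + s *\<^sub>R w))"
    have G: "(G has_derivative ?G) (at (a + s *\<^sub>R w))"
      using Suc.prems assms(3)[OF that] by (simp add: frechet_derivative_works)
    have "((\<lambda>s. a + s *\<^sub>R w) has_derivative (\<lambda>h. h *\<^sub>R w)) (at s)"
      by (auto intro!: derivative_eq_intros)
    from has_derivative_compose[OF this G]
    have "((\<lambda>s. c *\<^sub>R G (a + s *\<^sub>R w)) has_derivative (\<lambda>h. c *\<^sub>R ?G (h *\<^sub>R w))) (at s)"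
      by (rule has_derivative_scaleR_right)
    moreover have "?G (h *\<^sub>R w) = h *\<^sub>R ?G w" for h
      using has_derivative_linear[OF G] by (rule linear_scale)
    ultimately show ?thesis by simp
  qed
  have "C_diff_open k I (\<lambda>s. frechet_derivative (\<lambda>s. c *\<^sub>R G (a + s *\<^sub>R w)) (at s) v)" for v
  proof (rule C_diff_open_cong[OF \<open>open I\<close>])
    show "C_diff_open k I (\<lambda>s. (c * v) *\<^sub>R frechet_derivative G (at (a + s *\<^sub>R w)) w)"
      by (rule Suc.IH) (use Suc.prems in auto)
  qed (use frechet_derivative_at[OF deriv] in metis)
  then show ?case using deriv by (auto simp: differentiable_def)
qed

text \<open>Composition with \<open>P\<close> extends a map or form known only on \<open>S\<close>
  to the whole space, and \<open>v - P v = 0\<close> tests membership in \<open>S\<close>.\<close>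

lemma subspace_projection:
  fixes S :: "'a::real_vector set"
  assumes "subspace S"
  obtains P where "linear P" "\<And>v. P v \<in> S" "\<And>v. v \<in> S \<Longrightarrow> P v = v"
  using linear_exists_left_inverse_on[OF linear_ident assms] by auto

text \<open>\<open>A q\<close> is the derivative of the inverse chart at the image of
  \<open>q\<close>. It carries one fixed subspace onto the tangent space at every point of
  \<open>M\<close> near \<open>p\<close>. As \<open>A q w\<close> is continuous in \<open>q\<close>,
  a tangent vector at \<open>p\<close> extends to tangent vectors at nearby points.\<close>

lemma submanifold_chart:
  fixes M :: "'a::euclidean_space set"
  assumes "embedded_submanifold d M" "p \<in> M"
  obtains U A and S :: "'a set" where "open U" "p \<in> U" "subspace S" "dim S = d"
    "\<And>q. q \<in> U \<Longrightarrow> linear (A q)" "\<And>q. q \<in> U \<Longrightarrow> inj (A q)"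
    "\<And>w. continuous_on U (\<lambda>q. A q w)"
    "\<And>q. q \<in> M \<Longrightarrow> q \<in> U \<Longrightarrow> tangent_space M q = A q ` S"
proof -
  obtain U V \<phi> \<psi> and S :: "'a set" where U: "open U" "p \<in> U" and V: "open V"
    and hom: "homeomorphism U V \<phi> \<psi>" and sm: "smooth_open U \<phi>" "smooth_open V \<psi>"
    and S: "subspace S" "dim S = d" and slice: "\<phi> ` (M \<inter> U) = S \<inter> V"
    using assms unfolding embedded_submanifold_def by meson
  have \<phi>V: "\<phi> q \<in> V" and \<psi>\<phi>: "\<psi> (\<phi> q) = q" if "q \<in> U" for q
    using hom that by (auto simp: homeomorphism_def)
  have \<psi>U: "\<psi> y \<in> U" and \<phi>\<psi>: "\<phi> (\<psi> y) = y" if "y \<in> V" for y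
    using hom that by (auto simp: homeomorphism_def)
  define D where "D q = frechet_derivative \<phi> (at q)" for q
  define A where "A q = frechet_derivative \<psi> (at (\<phi> q))" for q
  have "C_diff_open (Suc 0) U \<phi>" and C\<psi>: "C_diff_open (Suc 0) V \<psi>"
    using sm unfolding smooth_open_def by blast+
  then have D: "(\<phi> has_derivative D q) (at q)"
    and A: "(\<psi> has_derivative A q) (at (\<phi> q))" if "q \<in> U" for q
    using that \<phi>V[OF that] unfolding D_def A_def frechet_derivative_works[symmetric] by simp_all
  \<comment> \<open>Differentiating \<open>\<psi> (\<phi> y) = y\<close>, and below
    \<open>\<phi> (\<psi> y) = y\<close>, shows that \<open>A q\<close> and \<open>D q\<close> are
    mutually inverse.\<close>
  have AD: "A q (D q v) = v" if "q \<in> U" for q v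
  proof -
    have "((\<lambda>y. \<psi> (\<phi> y)) has_derivative (\<lambda>h. A q (D q h))) (at q)"
      by (rule has_derivative_compose[OF D[OF that] A[OF that]])
    then have "((\<lambda>y. y) has_derivative (\<lambda>h. A q (D q h))) (at q)"
      by (rule has_derivative_transform_within_open[OF _ U(1) that]) (simp add: \<psi>\<phi>)
    from has_derivative_unique[OF this has_derivative_ident] show ?thesis by metis
  qed
  have DA: "D q (A q v) = v" if "q \<in> U" for q v
  proof -
    have D': "(\<phi> has_derivative D q) (at (\<psi> (\<phi> q)))" using D[OF that] \<psi>\<phi>[OF that] by simp
    have "((\<lambda>y. \<phi> (\<psi> y)) has_derivative (\<lambda>h. D q (A q h))) (at (\<phi> q))"
      by (rule has_derivative_compose[OF A[OF that] D'])
    then have "((\<lambda>y. y) has_derivative (\<lambda>h. D q (A q h))) (at (\<phi> q))"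
      by (rule has_derivative_transform_within_open[OF _ V \<phi>V[OF that]]) (simp add: \<phi>\<psi>)
    from has_derivative_unique[OF this has_derivative_ident] show ?thesis by metis
  qed
  have cont: "continuous_on U (\<lambda>q. A q w)" for w
    unfolding A_def
  proof (rule continuous_on_compose2[of V "\<lambda>y. frechet_derivative \<psi> (at y) w"])
    show "continuous_on U \<phi>" using hom by (simp add: homeomorphism_def)
  qed (use C\<psi> \<phi>V in auto)
  have tangent: "tangent_space M q = A q ` S" if q: "q \<in> M" "q \<in> U" for q
  proof (intro equalityI subsetI)
    fix v assume "v \<in> tangent_space M q"
    then obtain \<gamma> e where "e > 0" and \<gamma>M: "\<gamma> ` {-e<..<e} \<subseteq> M" and \<gamma>0: "\<gamma> 0 = q"
      and \<gamma>v: "(\<gamma> has_vector_derivative v) (at 0)"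
      unfolding tangent_space_def curve_through_def by auto
    \<comment> \<open>In the chart the curve runs inside \<open>S\<close>, so
      \<open>\<phi> (\<gamma> s) - P (\<phi> (\<gamma> s))\<close> vanishes near \<open>0\<close>.
      Its derivative is then zero, which says that \<open>P\<close> fixes \<open>D q v\<close>,
      hence \<open>D q v\<close> lies in \<open>S\<close>.\<close>
    obtain P where P: "linear P" "\<And>v. P v \<in> S" "\<And>v. v \<in> S \<Longrightarrow> P v = v"
      using subspace_projection[OF S(1)] by blast
    have "\<gamma> \<midarrow>0\<rightarrow> q"
      using has_vector_derivative_continuous[OF \<gamma>v] \<gamma>0 by (simp add: isCont_def)
    then have "eventually (\<lambda>s. \<gamma> s \<in> U) (at 0)" using U(1) q(2) by (rule topological_tendstoD)
    moreover have "eventually (\<lambda>s. s \<in> {-e<..<e}) (at 0)"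
      by (rule eventually_at_in_open') (use \<open>e > 0\<close> in auto)
    ultimately have ev: "eventually (\<lambda>s. \<phi> (\<gamma> s) - P (\<phi> (\<gamma> s)) = 0) (at 0)"
    proof eventually_elim
      case (elim s)
      then have "\<phi> (\<gamma> s) \<in> S" using slice \<gamma>M by blast
      then show ?case using P(3) by simp
    qed
    have "\<phi> (\<gamma> 0) \<in> S" using slice q \<gamma>0 by blast
    then have at0: "\<phi> (\<gamma> 0) - P (\<phi> (\<gamma> 0)) = 0" using P(3) by simp
    have \<phi>\<gamma>: "((\<lambda>s. \<phi> (\<gamma> s)) has_derivative (\<lambda>h. D q (h *\<^sub>R v))) (at 0)"
      using has_derivative_compose[OF \<gamma>v[unfolded has_vector_derivative_def]] D[OF q(2)] \<gamma>0
      by simp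
    have "((\<lambda>s. \<phi> (\<gamma> s) - P (\<phi> (\<gamma> s))) has_derivative
        (\<lambda>h. D q (h *\<^sub>R v) - P (D q (h *\<^sub>R v)))) (at 0)"
      using has_derivative_diff[OF \<phi>\<gamma> bounded_linear.has_derivative[OF _ \<phi>\<gamma>]] P(1)
      by (simp add: linear_conv_bounded_linear)
    then have "((\<lambda>s. 0) has_derivative (\<lambda>h. D q (h *\<^sub>R v) - P (D q (h *\<^sub>R v)))) (at (0::real))"
      by (rule has_derivative_transform_eventually[OF _ ev at0]) simp
    from has_derivative_unique[OF this has_derivative_const]
    have "D q (1 *\<^sub>R v) - P (D q (1 *\<^sub>R v)) = 0" by metis
    then have "D q v \<in> S" using P(2)[of "D q v"] by simp
    then show "v \<in> A q ` S" using AD[OF q(2)] by (metis imageI)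
  next
    fix v assume "v \<in> A q ` S"
    then obtain w where w: "w \<in> S" "v = A q w" by blast
    obtain r where r: "r > 0" "ball (\<phi> q) r \<subseteq> V"
      using V \<phi>V[OF q(2)] openE by blast
    \<comment> \<open>For \<open>\<bar>s\<bar> < e\<close> the point
      \<open>\<phi> q + s *\<^sub>R w\<close> stays in the ball of radius \<open>r\<close>; the
      summand \<open>1\<close> keeps the quotient meaningful for \<open>w = 0\<close>.\<close>
    define e where "e = r / (norm w + 1)"
    have "e > 0" using r by (simp add: e_def add_nonneg_pos)
    have inV: "\<phi> q + s *\<^sub>R w \<in> V" if "s \<in> {-e<..<e}" for s
    proof -
      have "\<bar>s\<bar> * norm w \<le> \<bar>s\<bar> * (norm w + 1)" by (simp add: mult_left_mono)
      also have "\<dots> < e * (norm w + 1)"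
        using that by (intro mult_strict_right_mono) (auto simp: add_nonneg_pos)
      also have "\<dots> = r" using add_nonneg_pos[OF norm_ge_zero[of w] zero_less_one] by (simp add: e_def)
      finally show ?thesis using r(2) by (auto simp: dist_norm subset_iff)
    qed
    \<comment> \<open>The curve is the image under the inverse chart of a straight line in
      \<open>S\<close>. The factor \<open>1\<close> gives it the form treated in
      \<open>C_diff_open_line\<close>.\<close>
    define \<gamma> where "\<gamma> s = 1 *\<^sub>R \<psi> (\<phi> q + s *\<^sub>R w)" for s
    have "smooth_open {-e<..<e} \<gamma>"
      unfolding smooth_open_def \<gamma>_def
      using sm(2) inV by (auto simp: smooth_open_def simp del: scaleR_one intro!: C_diff_open_line[of _ V])
    moreover have "\<gamma> s \<in> M" if "s \<in> {-e<..<e}" for s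
    proof -
      have "\<phi> q \<in> S" using slice q by blast
      then have "\<phi> q + s *\<^sub>R w \<in> S \<inter> V"
        using inV[OF that] w(1) S(1) by (auto intro: subspace_add subspace_scale)
      then have "\<phi> q + s *\<^sub>R w \<in> \<phi> ` (M \<inter> U)" using slice by simp
      then obtain y where "y \<in> M" "y \<in> U" "\<phi> y = \<phi> q + s *\<^sub>R w" by auto
      then show ?thesis unfolding \<gamma>_def using \<psi>\<phi>[of y] by simp
    qed
    moreover have "\<gamma> 0 = q" using \<psi>\<phi>[OF q(2)] by (simp add: \<gamma>_def)
    moreover have "(\<gamma> has_vector_derivative v) (at 0)"
    proof -
      have "((\<lambda>s. \<phi> q + s *\<^sub>R w) has_derivative (\<lambda>h. h *\<^sub>R w)) (at (0::real))"
        by (auto intro!: derivative_eq_intros)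
      from has_derivative_compose[OF this, of \<psi> "A q"] A[OF q(2)]
      have "(\<gamma> has_derivative (\<lambda>h. A q (h *\<^sub>R w))) (at 0)" by (simp add: \<gamma>_def[abs_def])
      moreover have "A q (h *\<^sub>R w) = h *\<^sub>R v" for h
        using has_derivative_linear[OF A[OF q(2)]] w(2) by (simp add: linear_scale)
      ultimately show ?thesis by (simp add: has_vector_derivative_def)
    qed
    ultimately have "curve_through M q v \<gamma>"
      using \<open>e > 0\<close> unfolding curve_through_def by blast
    then show "v \<in> tangent_space M q" unfolding tangent_space_def by blast
  qed
  show ?thesis
  proof (rule that[of U S A])
    show "inj (A q)" if "q \<in> U" for q using DA[OF that] by (metis injI)
    show "linear (A q)" if "q \<in> U" for q using A[OF that] by (rule has_derivative_linear)
  qed (use U S cont tangent in auto)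
qed

lemma tangent_space_subspace:
  assumes "embedded_submanifold d M" "p \<in> M"
  shows "subspace (tangent_space M p)" "dim (tangent_space M p) = d"
proof -
  obtain U A and S :: "'a set" where "open U" "p \<in> U" and S: "subspace S" "dim S = d"
    and A: "\<And>q. q \<in> U \<Longrightarrow> linear (A q)" "\<And>q. q \<in> U \<Longrightarrow> inj (A q)"
    and "\<And>w. continuous_on U (\<lambda>q. A q w)"
    and tangent: "\<And>q. q \<in> M \<Longrightarrow> q \<in> U \<Longrightarrow> tangent_space M q = A q ` S"
    by (rule submanifold_chart[OF assms]) (rule that)
  note p = A[OF \<open>p \<in> U\<close>] tangent[OF assms(2) \<open>p \<in> U\<close>]
  show "subspace (tangent_space M p)"
    unfolding p(3) using p(1) S(1) by (rule linear_subspace_image)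
  show "dim (tangent_space M p) = d"
    using dim_image_eq[OF p(1) inj_on_subset[OF p(2) subset_UNIV], of S] p(3) S(2) by simp
qed

text \<open>By the chain rule for a local ambient extension \<open>F\<close>, every curve with
  velocity \<open>v\<close> yields the same derivative. Since \<open>v\<close> is the velocity of
  some curve, the description in \<open>differential\<close> has exactly one solution.\<close>

lemma differential_eq:
  assumes "open U" "q \<in> U" "F differentiable (at q)" "\<And>y. y \<in> M \<Longrightarrow> y \<in> U \<Longrightarrow> F y = f y"
    and "v \<in> tangent_space M q"
  shows "differential M f q v = frechet_derivative F (at q) v"
proof -
  have F: "(F has_derivative frechet_derivative F (at q)) (at q)"
    using assms(3) by (simp add: frechet_derivative_works)
  have deriv: "((f \<circ> \<gamma>) has_real_derivative frechet_derivative F (at q) v) (at 0)"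
    if c: "curve_through M q v \<gamma>" for \<gamma>
  proof -
    obtain e where "e > 0" and \<gamma>M: "\<gamma> ` {-e<..<e} \<subseteq> M" and \<gamma>0: "\<gamma> 0 = q"
      and \<gamma>v: "(\<gamma> has_vector_derivative v) (at 0)"
      using c unfolding curve_through_def by auto
    have F\<gamma>: "((\<lambda>s. F (\<gamma> s)) has_derivative (\<lambda>h. frechet_derivative F (at q) (h *\<^sub>R v))) (at 0)"
      using has_derivative_compose[OF \<gamma>v[unfolded has_vector_derivative_def]] F \<gamma>0 by simp
    have "\<gamma> \<midarrow>0\<rightarrow> q"
      using has_vector_derivative_continuous[OF \<gamma>v] \<gamma>0 by (simp add: isCont_def)
    then have "eventually (\<lambda>s. \<gamma> s \<in> U) (at 0)" using assms(1,2) by (rule topological_tendstoD)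
    moreover have "eventually (\<lambda>s. s \<in> {-e<..<e}) (at 0)"
      by (rule eventually_at_in_open') (use \<open>e > 0\<close> in auto)
    ultimately have ev: "eventually (\<lambda>s. F (\<gamma> s) = f (\<gamma> s)) (at 0)"
      by eventually_elim (use assms(4) \<gamma>M in \<open>auto simp: image_subset_iff\<close>)
    have at0: "F (\<gamma> 0) = f (\<gamma> 0)"
      using assms(2,4) \<gamma>M \<gamma>0 \<open>e > 0\<close> by (metis greaterThanLessThan_iff imageI neg_less_0_iff_less subsetD)
    have "((\<lambda>s. f (\<gamma> s)) has_derivative (\<lambda>h. frechet_derivative F (at q) (h *\<^sub>R v))) (at 0)"
      by (rule has_derivative_transform_eventually[OF F\<gamma> ev at0]) simp
    moreover have "frechet_derivative F (at q) (h *\<^sub>R v) = frechet_derivative F (at q) v * h" for h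
      using has_derivative_linear[OF F] by (simp add: linear_scale)
    ultimately show ?thesis by (simp add: has_field_derivative_def o_def)
  qed
  obtain \<gamma> where "curve_through M q v \<gamma>" using assms(5) unfolding tangent_space_def by blast
  then show ?thesis unfolding differential_def
    using deriv DERIV_unique by (intro the_equality) blast+
qed

section \<open>Inner products on subspaces\<close>

text \<open>The axioms are restricted to \<open>S\<close> because a Riemannian metric constrains
  \<open>g p\<close> on the tangent space at \<open>p\<close> only.\<close>

locale inner_on =
  fixes S :: "'a::euclidean_space set" and B :: "'a \<Rightarrow> 'a \<Rightarrow> real"
  assumes subspace: "subspace S"
    and sym: "u \<in> S \<Longrightarrow> v \<in> S \<Longrightarrow> B u v = B v u"
    and lin: "u \<in> S \<Longrightarrow> v \<in> S \<Longrightarrow> w \<in> S \<Longrightarrow> B (a *\<^sub>R u + b *\<^sub>R v) w = a * B u w + b * B v w"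
    and pos: "v \<in> S \<Longrightarrow> v \<noteq> 0 \<Longrightarrow> B v v > 0"
begin

abbreviation nrm where "nrm v \<equiv> sqrt (B v v)"

lemma zero: "w \<in> S \<Longrightarrow> B 0 w = 0"
  using lin[of w w w 0 0] by simp

lemma lin_right:
  assumes "u \<in> S" "v \<in> S" "w \<in> S"
  shows "B w (a *\<^sub>R u + b *\<^sub>R v) = a * B w u + b * B w v"
proof -
  have "a *\<^sub>R u + b *\<^sub>R v \<in> S" using assms subspace by (simp add: subspace_add subspace_scale)
  then show ?thesis using lin[OF assms] sym assms by metis
qed

lemma nonneg: "v \<in> S \<Longrightarrow> B v v \<ge> 0"
  using pos[of v] zero[of v] by fastforce

lemma nrm_power2: "v \<in> S \<Longrightarrow> (nrm v)\<^sup>2 = B v v"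
  using nonneg by simp

lemma expand:
  assumes "u \<in> S" "v \<in> S"
  shows "B (a *\<^sub>R u + b *\<^sub>R v) (a *\<^sub>R u + b *\<^sub>R v) = a\<^sup>2 * B u u + 2 * a * b * B u v + b\<^sup>2 * B v v"
proof -
  have "a *\<^sub>R u + b *\<^sub>R v \<in> S" using assms subspace by (simp add: subspace_add subspace_scale)
  then show ?thesis using assms sym[of u v]
    by (simp add: lin lin_right power2_eq_square algebra_simps)
qed

lemma Cauchy_Schwarz:
  assumes "u \<in> S" "v \<in> S"
  shows "\<bar>B u v\<bar> \<le> nrm u * nrm v"
proof (cases "v = 0")
  case True
  then show ?thesis using zero sym assms nonneg by (metis abs_zero mult_zero_right order_refl real_sqrt_zero)
next
  case False
  define c where "c = B v v"
  have c: "c > 0" using pos[OF assms(2) False] by (simp add: c_def)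
  \<comment> \<open>This vector is \<open>c\<close> times the component of \<open>u\<close>
    orthogonal to \<open>v\<close>. Its square norm, which is nonnegative, is \<open>c\<close> times
    the Gram determinant of \<open>u\<close> and \<open>v\<close>.\<close>
  have "c *\<^sub>R u + (- B u v) *\<^sub>R v \<in> S"
    using assms subspace by (intro subspace_add subspace_scale)
  from nonneg[OF this] have "0 \<le> c * (c * B u u - (B u v)\<^sup>2)"
    unfolding expand[OF assms] c_def by (simp add: power2_eq_square algebra_simps)
  then have "(B u v)\<^sup>2 \<le> B u u * B v v"
    using c by (simp add: zero_le_mult_iff c_def mult.commute)
  then have "sqrt ((B u v)\<^sup>2) \<le> sqrt (B u u * B v v)" by (rule real_sqrt_le_mono)
  then show ?thesis by (simp add: real_sqrt_mult)
qed

lemma triangle: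
  assumes "u \<in> S" "v \<in> S"
  shows "nrm (u + v) \<le> nrm u + nrm v"
proof (rule real_le_lsqrt)
  have "B (u + v) (u + v) = B u u + 2 * B u v + B v v" using expand[OF assms, of 1 1] by simp
  also have "\<dots> \<le> (nrm u)\<^sup>2 + 2 * (nrm u * nrm v) + (nrm v)\<^sup>2"
    using Cauchy_Schwarz[OF assms] assms by (simp add: nrm_power2)
  finally show "B (u + v) (u + v) \<le> (nrm u + nrm v)\<^sup>2" by (simp add: power2_sum)
qed (use assms nonneg in auto)

lemma eqI:
  assumes "u \<in> S" "v \<in> S" "\<And>w. w \<in> S \<Longrightarrow> B u w = B v w"
  shows "u = v"
proof (rule ccontr)
  assume "u \<noteq> v"
  have S: "u - v \<in> S" using assms subspace by (simp add: subspace_diff)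
  then have "B (u - v) (u - v) = 0"
    using lin[OF assms(1,2) S, of 1 "-1"] assms(3)[OF S] by simp
  then show False using pos[OF S] \<open>u \<noteq> v\<close> by simp
qed

text \<open>With a projection \<open>P\<close> onto \<open>S\<close>, the form \<open>B (P u) (P v) + (u - P u) \<bullet> (v - P v)\<close> is positive
  definite on the whole space, so the linear map representing it is injective, hence onto.\<close>

lemma Riesz:
  assumes "linear l"
  shows "\<exists>\<xi>\<in>S. \<forall>v\<in>S. B \<xi> v = l v"
proof -
  obtain P where P: "linear P" "\<And>v. P v \<in> S" "\<And>v. v \<in> S \<Longrightarrow> P v = v"
    using subspace_projection[OF subspace] by blast
  define Q where "Q u v = B (P u) (P v) + (u - P u) \<bullet> (v - P v)" for u v
  define \<Lambda> where "\<Lambda> u = (\<Sum>b\<in>Basis. Q u b *\<^sub>R b)" for u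
  have Qlin: "Q (a *\<^sub>R u + b *\<^sub>R v) w = a * Q u w + b * Q v w" for a b u v w
    using P lin[of "P u" "P v" "P w" a b]
    by (simp add: Q_def linear_add linear_scale algebra_simps inner_simps)
  have Qlin_right: "Q w (a *\<^sub>R u + b *\<^sub>R v) = a * Q w u + b * Q w v" for a b u v w
    using P lin_right[of "P u" "P v" "P w" a b]
    by (simp add: Q_def linear_add linear_scale algebra_simps inner_simps)
  have rep: "(\<Sum>b\<in>Basis. h b *\<^sub>R b) \<bullet> v = h v" if "linear h" for h :: "'a \<Rightarrow> real" and v
  proof -
    have "h v = h (\<Sum>b\<in>Basis. (v \<bullet> b) *\<^sub>R b)" by (simp add: euclidean_representation)
    also have "\<dots> = (\<Sum>b\<in>Basis. (v \<bullet> b) * h b)" using that by (simp add: linear_sum linear_scale)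
    finally show ?thesis by (simp add: inner_sum_left inner_commute[of v] mult.commute)
  qed
  have "linear (Q u)" for u
    using Qlin_right[of u 1 _ 1] Qlin_right[of u _ _ 0] by (intro linearI) simp_all
  then have \<Lambda>: "\<Lambda> u \<bullet> v = Q u v" for u v
    unfolding \<Lambda>_def by (rule rep)
  have lin\<Lambda>: "linear \<Lambda>"
  proof (rule linearI)
    show "\<Lambda> (u + v) = \<Lambda> u + \<Lambda> v" for u v
      by (rule euclidean_eqI) (use Qlin[of 1 u 1 v] in \<open>simp add: \<Lambda> inner_simps\<close>)
    show "\<Lambda> (c *\<^sub>R u) = c *\<^sub>R \<Lambda> u" for c u
      by (rule euclidean_eqI) (use Qlin[of c u 0 u] in \<open>simp add: \<Lambda> inner_simps\<close>)
  qed
  have "inj \<Lambda>"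
    unfolding linear_injective_0[OF lin\<Lambda>]
  proof (intro allI impI)
    fix u assume "\<Lambda> u = 0"
    then have *: "B (P u) (P u) + (u - P u) \<bullet> (u - P u) = 0" using \<Lambda>[of u u] by (simp add: Q_def)
    have "B (P u) (P u) \<ge> 0" by (rule nonneg[OF P(2)])
    then have "B (P u) (P u) = 0" "(u - P u) \<bullet> (u - P u) = 0"
      using * inner_ge_zero[of "u - P u"] by linarith+
    then show "u = 0" using pos[OF P(2), of u] by fastforce
  qed
  then have "surj \<Lambda>" by (rule linear_injective_imp_surjective[OF lin\<Lambda>]) simp
  then obtain u where u: "\<Lambda> u = (\<Sum>b\<in>Basis. l b *\<^sub>R b)" by (metis surjD)
  \<comment> \<open>For \<open>v\<close> in \<open>S\<close> the term \<open>v - P v\<close> is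
    zero, so \<open>Q u v\<close> reduces to \<open>B (P u) v\<close>, and \<open>P u\<close> is the
    representing vector.\<close>
  have "B (P u) v = l v" if "v \<in> S" for v
    using \<Lambda>[of u v] rep[OF assms, of v] P(3)[OF that] by (simp add: u Q_def)
  then show ?thesis using P(2) by blast
qed

end

text \<open>As \<open>h\<close> is linear only on \<open>S\<close>, it is replaced by
  \<open>h \<circ> P\<close>, which is linear everywhere and has the same image of \<open>S\<close>.
  Injectivity preserves the dimension, and a subspace of \<open>W\<close> of full dimension is
  \<open>W\<close>.\<close>

lemma equal_dim_image_eq:
  fixes S W :: "'a::euclidean_space set"
  assumes "subspace S" "subspace W" "dim S = dim W" "h ` S \<subseteq> W"
    and lin: "\<And>u v a b. u \<in> S \<Longrightarrow> v \<in> S \<Longrightarrow> h (a *\<^sub>R u + b *\<^sub>R v) = a *\<^sub>R h u + b *\<^sub>R h v"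
    and inj: "inj_on h S"
  shows "h ` S = W"
proof -
  obtain P where P: "linear P" "\<And>v. P v \<in> S" "\<And>v. v \<in> S \<Longrightarrow> P v = v"
    using subspace_projection[OF assms(1)] by blast
  have L: "linear (h \<circ> P)"
    using P lin[of "P _" "P _" 1 1] lin[of "P _" "P _" _ 0]
    by (intro linearI) (simp_all add: linear_add linear_scale)
  have im: "(h \<circ> P) ` S = h ` S" using P(3) by (auto simp: image_iff)
  have "inj_on (h \<circ> P) S" using inj P(3) by (simp add: inj_on_def)
  then have "dim (h ` S) = dim S"
    using dim_image_eq[OF L] assms(1) im by (metis span_eq_iff)
  moreover have "subspace (h ` S)" using linear_subspace_image[OF L assms(1)] im by simp
  ultimately show ?thesis using subspace_dim_equal assms(2-4) by (metis order_refl)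
qed

section \<open>Gradients and isometric transports\<close>

lemma tangent_inner_on:
  assumes "embedded_submanifold d M" "riemannian_metric M g" "p \<in> M"
  shows "inner_on (tangent_space M p) (g p)"
proof
  show "subspace (tangent_space M p)" using tangent_space_subspace assms by blast
qed (use assms(2,3) in \<open>auto simp: riemannian_metric_def\<close>)

text \<open>The differential is the restriction of a linear functional, the derivative of a local
  extension of \<open>f\<close>. \<open>Riesz\<close> gives existence and \<open>eqI\<close>
  uniqueness of the vector described in \<open>grad\<close>.\<close>

lemma grad_properties:
  assumes "embedded_submanifold d M" "riemannian_metric M g" "C_diff_on 1 M f" "p \<in> M"
  shows "grad M g f p \<in> tangent_space M p"
    and "v \<in> tangent_space M p \<Longrightarrow> g p (grad M g f p) v = differential M f p v"
proof -
  interpret inner_on "tangent_space M p" "g p" using assms by (intro tangent_inner_on)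
  obtain U F where U: "open U" "p \<in> U" "C_diff_open 1 U F" "\<forall>y\<in>M \<inter> U. F y = f y"
    using assms(3,4) unfolding C_diff_on_def by blast
  then have F: "F differentiable (at p)" by simp
  have eq: "differential M f p v = frechet_derivative F (at p) v" if "v \<in> tangent_space M p" for v
    using differential_eq[OF U(1,2) F _ that] U(4) by blast
  have "linear (frechet_derivative F (at p))"
    using F by (simp add: frechet_derivative_works has_derivative_linear)
  from Riesz[OF this] obtain \<xi> where "\<xi> \<in> tangent_space M p"
    "\<forall>v\<in>tangent_space M p. g p \<xi> v = differential M f p v" using eq by auto
  then have "\<exists>!\<xi>. \<xi> \<in> tangent_space M p \<and> (\<forall>v\<in>tangent_space M p. g p \<xi> v = differential M f p v)"
    using eqI by (metis (no_types, lifting))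
  from theI'[OF this] show "grad M g f p \<in> tangent_space M p"
    and "v \<in> tangent_space M p \<Longrightarrow> g p (grad M g f p) v = differential M f p v"
    unfolding grad_def by blast+
qed

text \<open>\<open>inv_into\<close> is a genuine inverse only once the transport is onto. Isometry
  makes it injective, since it preserves products with all tangent vectors, and equality of
  dimensions then makes it surjective.\<close>

lemma inverse_transport_isometric:
  assumes "embedded_submanifold d M" "riemannian_metric M g" "manifold_retraction M R"
    and T: "vector_transport M R T" and iso: "isometric_transport M g R T"
    and p: "p \<in> M" and \<eta>: "\<eta> \<in> tangent_space M p" and \<zeta>: "\<zeta> \<in> tangent_space M (R p \<eta>)"
  shows "inverse_transport M T p \<eta> \<zeta> \<in> tangent_space M p"
    and "metric_norm g p (inverse_transport M T p \<eta> \<zeta>) = metric_norm g (R p \<eta>) \<zeta>"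
proof -
  let ?S = "tangent_space M p" and ?W = "tangent_space M (R p \<eta>)"
  have R: "R p \<eta> \<in> M" using assms(3) p \<eta> unfolding manifold_retraction_def by blast
  interpret S: inner_on ?S "g p" using assms by (intro tangent_inner_on)
  interpret W: inner_on ?W "g (R p \<eta>)" using assms R by (intro tangent_inner_on)
  have lin: "T p \<eta> (a *\<^sub>R u + b *\<^sub>R v) = a *\<^sub>R T p \<eta> u + b *\<^sub>R T p \<eta> v"
    if "u \<in> ?S" "v \<in> ?S" for u v a b
    using T p \<eta> that unfolding vector_transport_def by blast
  have isoT: "g (R p \<eta>) (T p \<eta> u) (T p \<eta> v) = g p u v" if "u \<in> ?S" "v \<in> ?S" for u v
    using iso p \<eta> that unfolding isometric_transport_def by blast
  have "inj_on (T p \<eta>) ?S"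
  proof (rule inj_onI)
    fix u v assume uv: "u \<in> ?S" "v \<in> ?S" "T p \<eta> u = T p \<eta> v"
    then show "u = v" using isoT by (intro S.eqI) metis+
  qed
  then have "T p \<eta> ` ?S = ?W"
    using T p \<eta> tangent_space_subspace[OF assms(1)] R lin
    by (intro equal_dim_image_eq) (auto simp: vector_transport_def)
  then have im: "\<zeta> \<in> T p \<eta> ` ?S" using \<zeta> by simp
  then show I: "inverse_transport M T p \<eta> \<zeta> \<in> ?S"
    unfolding inverse_transport_def by (rule inv_into_into)
  have "T p \<eta> (inverse_transport M T p \<eta> \<zeta>) = \<zeta>"
    unfolding inverse_transport_def using im by (rule f_inv_into_f)
  then show "metric_norm g p (inverse_transport M T p \<eta> \<zeta>) = metric_norm g (R p \<eta>) \<zeta>"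
    unfolding metric_norm_def using isoT[OF I I] by simp
qed

text \<open>Only the values of \<open>f\<close> on \<open>M\<close> are regular, so continuity is
  taken from an ambient extension near \<open>p\<close> and applied to a sequence that stays in
  \<open>M\<close>.\<close>

lemma C_diff_on_tendsto:
  assumes "C_diff_on 1 M f" "p \<in> M" "y \<longlonglongrightarrow> p" "\<And>n. y n \<in> M"
  shows "(\<lambda>n. f (y n)) \<longlonglongrightarrow> f p"
proof -
  obtain U F where U: "open U" "p \<in> U" "C_diff_open 1 U F" "\<forall>y\<in>M \<inter> U. F y = f y"
    using assms(1,2) unfolding C_diff_on_def by blast
  then have "isCont F p" by (simp add: differentiable_imp_continuous_within)
  then have "(\<lambda>n. F (y n)) \<longlonglongrightarrow> F p" using assms(3) by (rule isCont_tendsto_compose)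
  moreover have "eventually (\<lambda>n. y n \<in> U) sequentially"
    using assms(3) U(1,2) by (rule topological_tendstoD)
  then have "eventually (\<lambda>n. F (y n) = f (y n)) sequentially"
    by eventually_elim (use U(4) assms(4) in auto)
  ultimately have "(\<lambda>n. f (y n)) \<longlonglongrightarrow> F p" by (rule Lim_transform_eventually)
  then show ?thesis using U assms(2) by auto
qed

text \<open>A tangent vector \<open>v = A p w\<close> at the limit is approximated by the tangent vectors
  \<open>A (y n) w\<close> along the sequence, on which the differential is bounded by Cauchy-Schwarz.\<close>

lemma stationary_limit:
  fixes M :: "'a::euclidean_space set"
  assumes M: "embedded_submanifold d M" and g: "riemannian_metric M g" and f: "C_diff_on 1 M f"
    and p: "p \<in> M" and lim: "y \<longlonglongrightarrow> p" and yM: "\<And>n. y n \<in> M"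
    and grad0: "(\<lambda>n. metric_norm g (y n) (grad M g f (y n))) \<longlonglongrightarrow> 0"
  shows "grad M g f p = 0"
proof -
  obtain U A and S :: "'a set" where U: "open U" "p \<in> U" "subspace S"
    and cont: "\<And>w. continuous_on U (\<lambda>q. A q w)"
    and tangent: "\<And>q. q \<in> M \<Longrightarrow> q \<in> U \<Longrightarrow> tangent_space M q = A q ` S"
    using submanifold_chart[OF M p] by metis
  obtain V F where V: "open V" "p \<in> V" "C_diff_open 1 V F" "\<forall>y\<in>M \<inter> V. F y = f y"
    using f p unfolding C_diff_on_def by blast
  define F' where "F' q = frechet_derivative F (at q)" for q
  have F: "F differentiable (at q)" if "q \<in> V" for q using V(3) that by simp
  have F'lin: "linear (F' q)" if "q \<in> V" for q
    unfolding F'_def using F[OF that] by (simp add: frechet_derivative_works has_derivative_linear)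
  have F'cont: "continuous_on V (\<lambda>q. F' q b)" for b unfolding F'_def using V(3) by simp
  have diff: "differential M f q v = F' q v" if "q \<in> V" "v \<in> tangent_space M q" for q v
    unfolding F'_def using differential_eq[OF V(1) that(1) F[OF that(1)] _ that(2)] V(4) by blast
  have evU: "eventually (\<lambda>n. y n \<in> U) sequentially" and evV: "eventually (\<lambda>n. y n \<in> V) sequentially"
    using lim U V by (auto dest: topological_tendstoD)
  interpret p: inner_on "tangent_space M p" "g p" using M g p by (rule tangent_inner_on)
  have "g p (grad M g f p) v = g p 0 v" if v: "v \<in> tangent_space M p" for v
  proof -
    obtain w where w: "w \<in> S" "v = A p w" using tangent[OF p U(2)] v by blast
    define V' where "V' n = A (y n) w" for n
    have V': "V' \<longlonglongrightarrow> v"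
      unfolding V'_def w(2)
      using cont[of w] U(1,2) lim
      by (auto simp: continuous_on_eq_continuous_at intro: isCont_tendsto_compose)
    have tan: "eventually (\<lambda>n. V' n \<in> tangent_space M (y n)) sequentially"
      using evU by eventually_elim (use tangent yM w in \<open>auto simp: V'_def\<close>)
    \<comment> \<open>\<open>F' q b\<close> is known to be continuous in \<open>q\<close> for each
      fixed direction only. Expanding \<open>V' n\<close> over the basis yields the limit when point
      and direction vary together.\<close>
    have "(\<lambda>n. F' (y n) b) \<longlonglongrightarrow> F' p b" for b
      using F'cont[of b] V(1,2) lim
      by (auto simp: continuous_on_eq_continuous_at intro: isCont_tendsto_compose)
    then have "(\<lambda>n. \<Sum>b\<in>Basis. (V' n \<bullet> b) * F' (y n) b) \<longlonglongrightarrow> (\<Sum>b\<in>Basis. (v \<bullet> b) * F' p b)"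
      by (intro tendsto_sum tendsto_mult tendsto_inner tendsto_const V')
    moreover have expand: "(\<Sum>b\<in>Basis. (u \<bullet> b) * F' q b) = F' q u" if "q \<in> V" for q u
    proof -
      have "F' q u = F' q (\<Sum>b\<in>Basis. (u \<bullet> b) *\<^sub>R b)" by (simp add: euclidean_representation)
      also have "\<dots> = (\<Sum>b\<in>Basis. (u \<bullet> b) * F' q b)"
        using F'lin[OF that] by (simp add: linear_sum linear_scale)
      finally show ?thesis by simp
    qed
    ultimately have "(\<lambda>n. \<Sum>b\<in>Basis. (V' n \<bullet> b) * F' (y n) b) \<longlonglongrightarrow> F' p v"
      using V(2) by simp
    then have lim1: "(\<lambda>n. F' (y n) (V' n)) \<longlonglongrightarrow> F' p v"
    proof (rule Lim_transform_eventually)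
      show "\<forall>\<^sub>F n in sequentially. (\<Sum>b\<in>Basis. (V' n \<bullet> b) * F' (y n) b) = F' (y n) (V' n)"
        using evV by eventually_elim (rule expand)
    qed
    \<comment> \<open>The metric is regular only on the Whitney sum, hence the passage to a
      continuous extension \<open>G\<close> near \<open>(p, v, v)\<close>. The limit keeps the norms
      of \<open>V' n\<close> bounded in the Cauchy-Schwarz estimate.\<close>
    have lim2: "(\<lambda>n. g (y n) (V' n) (V' n)) \<longlonglongrightarrow> g p v v"
    proof -
      have "(p, v, v) \<in> tangent_whitney_sum M" using p v by (simp add: tangent_whitney_sum_def)
      then obtain O' G where G: "open O'" "(p, v, v) \<in> O'" "smooth_open O' G"
        "\<forall>z\<in>tangent_whitney_sum M \<inter> O'. G z = (case z of (x, v, w) \<Rightarrow> g x v w)"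
        using g unfolding riemannian_metric_def smooth_on_def by blast
      have "continuous_on O' G" using G(3) unfolding smooth_open_def by (metis C_diff_open.simps(1))
      then have "isCont G (p, v, v)" using G(1,2) continuous_on_eq_continuous_at by blast
      moreover have z: "(\<lambda>n. (y n, V' n, V' n)) \<longlonglongrightarrow> (p, v, v)" by (intro tendsto_Pair lim V')
      ultimately have "(\<lambda>n. G (y n, V' n, V' n)) \<longlonglongrightarrow> G (p, v, v)"
        by (rule isCont_tendsto_compose)
      moreover have "eventually (\<lambda>n. (y n, V' n, V' n) \<in> O') sequentially"
        using z G(1,2) by (rule topological_tendstoD)
      with tan have "eventually (\<lambda>n. G (y n, V' n, V' n) = g (y n) (V' n) (V' n)) sequentially"
        by eventually_elim (use G(4) yM in \<open>auto simp: tangent_whitney_sum_def\<close>)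
      ultimately have "(\<lambda>n. g (y n) (V' n) (V' n)) \<longlonglongrightarrow> G (p, v, v)"
        by (rule Lim_transform_eventually)
      then show ?thesis using G(2,4) \<open>(p, v, v) \<in> tangent_whitney_sum M\<close> by auto
    qed
    have "(\<lambda>n. F' (y n) (V' n)) \<longlonglongrightarrow> 0"
    proof (rule Lim_null_comparison)
      show "(\<lambda>n. metric_norm g (y n) (grad M g f (y n)) * sqrt (g (y n) (V' n) (V' n))) \<longlonglongrightarrow> 0"
        using tendsto_mult[OF grad0 tendsto_real_sqrt[OF lim2]] by simp
      show "\<forall>\<^sub>F n in sequentially. norm (F' (y n) (V' n))
          \<le> metric_norm g (y n) (grad M g f (y n)) * sqrt (g (y n) (V' n) (V' n))"
        using tan evV
      proof eventually_elim
        case (elim n)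
        interpret inner_on "tangent_space M (y n)" "g (y n)" using M g yM by (rule tangent_inner_on)
        have "F' (y n) (V' n) = g (y n) (grad M g f (y n)) (V' n)"
          using grad_properties(2)[OF M g f yM elim(1)] diff[OF elim(2,1)] by simp
        then show ?case
          using Cauchy_Schwarz[OF grad_properties(1)[OF M g f yM] elim(1)]
          by (simp add: metric_norm_def)
      qed
    qed
    then have "F' p v = 0" using lim1 LIMSEQ_unique by blast
    then show ?thesis
      using grad_properties(2)[OF M g f p v] diff[OF V(2) v] p.zero[OF v] by simp
  qed
  then show ?thesis
    using grad_properties(1)[OF M g f p] subspace_0[OF p.subspace] by (intro p.eqI) auto
qed

section \<open>The scalar recursion\<close>

text \<open>Subtracting the partial sums of \<open>e\<close> from \<open>u\<close> leaves a
  decreasing sequence bounded below. Telescoping the same inequality bounds the partial sums of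
  \<open>s\<close>. The terms of \<open>e\<close> may have either sign, so \<open>E\<close> bounds
  the absolute values of its partial sums.\<close>

lemma quasi_decreasing_convergent:
  fixes u s e :: "nat \<Rightarrow> real"
  assumes step: "\<And>k. u (Suc k) \<le> u k - s k + e k" and s: "\<And>k. s k \<ge> 0"
    and e: "summable e" and m: "\<And>k. m \<le> u k"
  shows "convergent u" "summable s"
proof -
  have conv: "convergent (\<lambda>k. \<Sum>i<k. e i)" using e by (simp add: summable_iff_convergent)
  then obtain E where E: "\<And>k. norm (\<Sum>i<k. e i) \<le> E"
    using convergent_imp_Bseq BseqE by blast
  have dec: "decseq (\<lambda>k. u k - (\<Sum>i<k. e i))"
    using step s by (intro decseq_SucI) (smt (verit) sum.lessThan_Suc)
  have "m - E \<le> u k - (\<Sum>i<k. e i)" for k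
    using m[of k] E[of k] by simp
  then have "Bseq (\<lambda>k. u k - (\<Sum>i<k. e i))" using decseq_bounded[OF dec] by blast
  then have "convergent (\<lambda>k. u k - (\<Sum>i<k. e i))"
    using decseq_imp_monoseq[OF dec] by (rule Bseq_monoseq_convergent)
  from convergent_add[OF this conv] show "convergent u" by simp
  have sum: "(\<Sum>i<k. s i) \<le> u 0 - u k + (\<Sum>i<k. e i)" for k
  proof (induction k)
    case (Suc k)
    then show ?case using step[of k] by simp
  qed simp
  have "(\<Sum>i<k. norm (s i)) \<le> u 0 - m + E" for k
    using sum[of k] m[of k] E[of k] s by simp
  then have "summable (\<lambda>i. norm (s i))"
    by (intro summableI_nonneg_bounded[where x = "u 0 - m + E"]) auto
  then show "summable s" using s by simp
qed

text \<open>Here \<open>F k\<close> is the function value and \<open>a k\<close> the gradient norm. Both \<open>F\<close> and \<open>a\<^sup>2\<close> turn out to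
  be decreasing up to summable errors.\<close>

lemma perturbed_descent_convergence:
  fixes F a t \<rho> :: "nat \<Rightarrow> real"
  assumes L: "L > 0" and a: "\<And>k. a k \<ge> 0" and t: "\<And>k. t k > 0" and \<rho>: "\<And>k. \<rho> k > 0"
    and F: "\<And>k. F (Suc k) \<le> F k - t k * ((a k)\<^sup>2 - L * \<rho> k * a k) + L / 2 * (t k * (a k + L * \<rho> k))\<^sup>2"
    and aS: "\<And>k. a (Suc k) \<le> a k + L * (t k * (a k + L * \<rho> k))"
    and m: "\<And>k. m \<le> F k"
    and r: "r < 2 / L" "\<And>k. \<rho> k \<le> r"
    and tsmall: "\<And>k. t k \<le> 1" "\<And>k. L * t k \<le> (1 - L * r / 2) / 2"
    and sum: "summable (\<lambda>k. t k * \<rho> k)" and div: "\<not> summable t"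
  shows "a \<longlonglongrightarrow> 0" "convergent F"
proof -
  \<comment> \<open>After \<open>young\<close> the coefficient of \<open>t k * (a k)\<^sup>2\<close>
    is \<open>1 - L * r / 2\<close>, positive because \<open>r < 2 / L\<close>. One half absorbs the
    quadratic term, as \<open>L * t k \<le> c\<close>; the other half is the net decrease.\<close>
  define c where "c = (1 - L * r / 2) / 2"
  have c: "c > 0" using r(1) L by (simp add: c_def field_simps)
  have rpos: "r > 0" using \<rho>[of 0] r(2)[of 0] by simp
  \<comment> \<open>The weight \<rho> is kept on the constant term, where it makes the error
    \<open>t k * \<rho> k\<close> summable, and is bounded by \<open>r\<close> only on the square.
    The next estimate likewise replaces just one of two factors \<rho> by \<open>r\<close>.\<close>
  have young: "2 * (\<rho> k * a k) \<le> r * (a k)\<^sup>2 + \<rho> k" for k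
  proof -
    have "0 \<le> \<rho> k * (a k - 1)\<^sup>2" using \<rho>[of k] by simp
    then have "2 * (\<rho> k * a k) \<le> \<rho> k * (a k)\<^sup>2 + \<rho> k"
      by (simp add: power2_eq_square algebra_simps)
    moreover have "\<rho> k * (a k)\<^sup>2 \<le> r * (a k)\<^sup>2" using r(2) by (intro mult_right_mono) auto
    ultimately show ?thesis by simp
  qed
  have sq: "(a k + L * \<rho> k)\<^sup>2 \<le> 2 * (a k)\<^sup>2 + 2 * L\<^sup>2 * r * \<rho> k" for k
  proof -
    have "(a k + L * \<rho> k)\<^sup>2 \<le> 2 * (a k)\<^sup>2 + 2 * (L * \<rho> k)\<^sup>2"
      using zero_le_power2[of "a k - L * \<rho> k"] unfolding power2_sum power2_diff by linarith
    moreover have "2 * (L * \<rho> k)\<^sup>2 \<le> 2 * L\<^sup>2 * r * \<rho> k"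
      using mult_left_mono[OF r(2)[of k], of "2 * L\<^sup>2 * \<rho> k"] \<rho>[of k] L
      by (simp add: power2_eq_square algebra_simps)
    ultimately show ?thesis by linarith
  qed
  have descent: "F (Suc k) \<le> F k - c * (t k * (a k)\<^sup>2) + (L / 2 + L ^ 3 * r) * (t k * \<rho> k)" for k
  proof -
    have tk: "t k > 0" by (rule t)
    have 1: "t k * (L * \<rho> k * a k) \<le> t k * (L / 2 * (r * (a k)\<^sup>2 + \<rho> k))"
      using mult_left_mono[OF young[of k], of "t k * L / 2"] L tk by (simp add: algebra_simps)
    have "(t k * (a k + L * \<rho> k))\<^sup>2 \<le> (t k)\<^sup>2 * (2 * (a k)\<^sup>2 + 2 * L\<^sup>2 * r * \<rho> k)"
      unfolding power_mult_distrib by (rule mult_left_mono[OF sq]) simp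
    then have "L / 2 * (t k * (a k + L * \<rho> k))\<^sup>2
        \<le> L / 2 * ((t k)\<^sup>2 * (2 * (a k)\<^sup>2 + 2 * L\<^sup>2 * r * \<rho> k))"
      using L by (intro mult_left_mono) auto
    also have "\<dots> = (L * t k) * (t k * (a k)\<^sup>2) + t k * (L ^ 3 * r * (t k * \<rho> k))"
      by (simp add: power2_eq_square power3_eq_cube algebra_simps)
    also have "\<dots> \<le> c * (t k * (a k)\<^sup>2) + 1 * (L ^ 3 * r * (t k * \<rho> k))"
      using tsmall[of k] tk \<rho>[of k] L rpos unfolding c_def
      by (intro add_mono mult_right_mono) (auto intro!: mult_nonneg_nonneg)
    finally have 2: "L / 2 * (t k * (a k + L * \<rho> k))\<^sup>2
        \<le> c * (t k * (a k)\<^sup>2) + L ^ 3 * r * (t k * \<rho> k)" by simp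
    have "c * (t k * (a k)\<^sup>2) = t k * (a k)\<^sup>2 - t k * (L / 2 * r * (a k)\<^sup>2) - c * (t k * (a k)\<^sup>2)"
      by (simp add: c_def field_simps)
    then show ?thesis using F[of k] 1 2 by (simp add: algebra_simps)
  qed
  have err: "summable (\<lambda>k. (L / 2 + L ^ 3 * r) * (t k * \<rho> k))"
    using sum by (rule summable_mult)
  have "0 \<le> c * (t k * (a k)\<^sup>2)" for k using c t[of k] by simp
  note quasi_decreasing_convergent[OF descent this err m]
  then have conv: "convergent F" and "summable (\<lambda>k. c * (t k * (a k)\<^sup>2))" by blast+
  then have ta: "summable (\<lambda>k. t k * (a k)\<^sup>2)" using c by simp
  \<comment> \<open>These terms arise from squaring the bound on \<open>a (Suc k)\<close>: the cross
    term gives \<open>2 * L\<close> directly and, through \<open>young\<close>,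
    \<open>L\<^sup>2 * r\<close> and \<open>L\<^sup>2\<close>; the square gives the rest through
    \<open>sq\<close> and \<open>(t k)\<^sup>2 \<le> t k\<close>. The \<open>- 0\<close> below is
    the choice of a zero sequence for \<open>s\<close>.\<close>
  define e where "e k = (2 * L + L\<^sup>2 * r + 2 * L\<^sup>2) * (t k * (a k)\<^sup>2) + (L\<^sup>2 + 2 * L ^ 4 * r) * (t k * \<rho> k)" for k
  have "(a (Suc k))\<^sup>2 \<le> (a k)\<^sup>2 - 0 + e k" for k
  proof -
    have tk: "t k > 0" by (rule t)
    have "(a (Suc k))\<^sup>2 \<le> (a k + L * (t k * (a k + L * \<rho> k)))\<^sup>2"
      using aS a by (intro power_mono)
    also have "\<dots> = (a k)\<^sup>2 + 2 * L * (t k * (a k)\<^sup>2) + L\<^sup>2 * t k * (2 * (\<rho> k * a k))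
        + L\<^sup>2 * ((t k)\<^sup>2 * (a k + L * \<rho> k)\<^sup>2)"
      by (simp add: power2_eq_square algebra_simps)
    also have "\<dots> \<le> (a k)\<^sup>2 + 2 * L * (t k * (a k)\<^sup>2) + L\<^sup>2 * t k * (r * (a k)\<^sup>2 + \<rho> k)
        + L\<^sup>2 * (t k * (2 * (a k)\<^sup>2 + 2 * L\<^sup>2 * r * \<rho> k))"
    proof -
      have "(t k)\<^sup>2 \<le> t k" using tsmall(1)[of k] tk by (simp add: power2_eq_square mult_left_le)
      then have "(t k)\<^sup>2 * (a k + L * \<rho> k)\<^sup>2 \<le> t k * (2 * (a k)\<^sup>2 + 2 * L\<^sup>2 * r * \<rho> k)"
        using sq[of k] tk by (intro mult_mono) auto
      then show ?thesis using young[of k] tk L by (intro add_mono mult_left_mono) auto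
    qed
    also have "\<dots> = (a k)\<^sup>2 - 0 + e k"
      by (simp add: e_def power2_eq_square power4_eq_xxxx algebra_simps)
    finally show ?thesis .
  qed
  moreover have "summable e" unfolding e_def by (intro summable_add summable_mult ta sum)
  ultimately have "convergent (\<lambda>k. (a k)\<^sup>2)"
    using quasi_decreasing_convergent(1)[of "\<lambda>k. (a k)\<^sup>2" "\<lambda>_. 0" e 0] by simp
  then obtain l where l: "(\<lambda>k. (a k)\<^sup>2) \<longlonglongrightarrow> l" unfolding convergent_def by blast
  have "l \<ge> 0" using l by (rule LIMSEQ_le_const) auto
  \<comment> \<open>With a positive limit, \<open>t k\<close> would eventually be at most
    \<open>2 / l\<close> times the summable \<open>t k * (a k)\<^sup>2\<close>.\<close>
  moreover have "\<not> l > 0"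
  proof
    assume "l > 0"
    then have "eventually (\<lambda>k. (a k)\<^sup>2 > l / 2) sequentially"
      by (intro order_tendstoD(1)[OF l]) simp
    then have "eventually (\<lambda>k. norm (t k) \<le> 2 / l * (t k * (a k)\<^sup>2)) sequentially"
    proof eventually_elim
      case (elim k)
      then have "t k * (l / 2) \<le> t k * (a k)\<^sup>2" using t[of k] by (intro mult_left_mono) auto
      then show ?case using \<open>l > 0\<close> t[of k] by (simp add: field_simps)
    qed
    then have "summable t" using summable_mult[OF ta] by (rule summable_comparison_test_ev)
    then show False using div by simp
  qed
  ultimately have "(\<lambda>k. (a k)\<^sup>2) \<longlonglongrightarrow> 0" using l by simp
  from tendsto_real_sqrt[OF this] show "a \<longlonglongrightarrow> 0" using a by simp
  show "convergent F" by (rule conv)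
qed

section \<open>Convergence of the method\<close>

text \<open>This reduces one iteration from \<open>p\<close> to \<open>q\<close> to scalars. The
  direction \<open>\<eta>\<close> has norm \<open>\<sigma>\<close>, so the Lipschitz condition puts
  the transported gradient \<open>D\<close> within \<open>L * \<sigma>\<close> of the gradient at
  \<open>p\<close>; the descent condition is then applied to
  \<open>- \<tau> *\<^sub>R D\<close>.\<close>

lemma rsam_step:
  fixes M :: "'a::euclidean_space set"
  assumes M: "embedded_submanifold d M" and g: "riemannian_metric M g" and R: "manifold_retraction M R"
    and T: "vector_transport M R T" and iso: "isometric_transport M g R T" and f: "C_diff_on 1 M f"
    and descent: "\<And>p \<eta>. p \<in> M \<Longrightarrow> \<eta> \<in> tangent_space M p \<Longrightarrow>
          f (R p \<eta>) \<le> f p + g p (grad M g f p) \<eta> + L / 2 * (metric_norm g p \<eta>)\<^sup>2"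
    and lipschitz: "\<And>p \<eta>. p \<in> M \<Longrightarrow> \<eta> \<in> tangent_space M p \<Longrightarrow>
          metric_norm g p (inverse_transport M T p \<eta> (grad M g f (R p \<eta>)) - grad M g f p)
            \<le> L * metric_norm g p \<eta>"
    and L: "L > 0" and p: "p \<in> M" and nz: "grad M g f p \<noteq> 0" and \<tau>: "\<tau> > 0" and \<sigma>: "\<sigma> > 0"
    and \<eta>: "\<eta> = rsam_direction M g f \<sigma> p"
    and q: "q = R p (- \<tau> *\<^sub>R inverse_transport M T p \<eta> (grad M g f (R p \<eta>)))"
    and a: "a = metric_norm g p (grad M g f p)"
  shows "q \<in> M"
    and "f q \<le> f p - \<tau> * (a\<^sup>2 - L * \<sigma> * a) + L / 2 * (\<tau> * (a + L * \<sigma>))\<^sup>2"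
    and "metric_norm g q (grad M g f q) \<le> a + L * (\<tau> * (a + L * \<sigma>))"
proof -
  let ?G = "grad M g f p" and ?S = "tangent_space M p"
  interpret inner_on ?S "g p" using M g p by (rule tangent_inner_on)
  have RM: "R p v \<in> M" if "v \<in> ?S" for v using R p that unfolding manifold_retraction_def by blast
  have G: "?G \<in> ?S" by (rule grad_properties(1)[OF M g f p])
  have scale: "metric_norm g p (c *\<^sub>R v) = \<bar>c\<bar> * metric_norm g p v" if "v \<in> ?S" for c v
    using expand[OF that that, of c 0] by (simp add: metric_norm_def real_sqrt_mult)
  have "a > 0" unfolding a metric_norm_def using pos[OF G nz] by simp
  have a2: "g p ?G ?G = a\<^sup>2" unfolding a metric_norm_def using nrm_power2[OF G] by simp
  have \<eta>S: "\<eta> \<in> ?S" unfolding \<eta> rsam_direction_def using G subspace by (simp add: subspace_scale)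
  have \<eta>n: "metric_norm g p \<eta> = \<sigma>"
    unfolding \<eta> rsam_direction_def scale[OF G] a[symmetric] using \<open>a > 0\<close> \<sigma> by simp
  define D where "D = inverse_transport M T p \<eta> (grad M g f (R p \<eta>))"
  have D: "D \<in> ?S"
    unfolding D_def using inverse_transport_isometric(1)[OF M g R T iso p \<eta>S]
      grad_properties(1)[OF M g f RM[OF \<eta>S]] .
  have DG: "metric_norm g p (D - ?G) \<le> L * \<sigma>"
    using lipschitz[OF p \<eta>S] unfolding D_def \<eta>n .
  have DGS: "D - ?G \<in> ?S" using D G subspace by (simp add: subspace_diff)
  have Dn: "metric_norm g p D \<le> a + L * \<sigma>"
    using triangle[OF DGS G] DG unfolding metric_norm_def a by simp
  define \<mu> where "\<mu> = - \<tau> *\<^sub>R D"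
  have \<mu>: "\<mu> \<in> ?S" unfolding \<mu>_def using D subspace by (simp add: subspace_scale subspace_neg)
  have q': "q = R p \<mu>" unfolding q \<mu>_def D_def ..
  show "q \<in> M" unfolding q' by (rule RM[OF \<mu>])
  have \<mu>n: "metric_norm g p \<mu> \<le> \<tau> * (a + L * \<sigma>)"
    unfolding \<mu>_def scale[OF D] using Dn \<tau> by (simp add: mult_left_mono)
  have "g p ?G D = a\<^sup>2 + g p ?G (D - ?G)"
    using lin_right[OF D G G, of 1 "-1"] a2 by simp
  moreover have "\<bar>g p ?G (D - ?G)\<bar> \<le> a * (L * \<sigma>)"
  proof (rule order_trans)
    show "\<bar>g p ?G (D - ?G)\<bar> \<le> a * metric_norm g p (D - ?G)"
      using Cauchy_Schwarz[OF G DGS] unfolding metric_norm_def a .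
  qed (use DG \<open>a > 0\<close> in \<open>simp add: mult_left_mono\<close>)
  ultimately have "g p ?G D \<ge> a\<^sup>2 - L * \<sigma> * a" by (simp add: abs_le_iff mult.commute)
  then have "g p ?G \<mu> \<le> - \<tau> * (a\<^sup>2 - L * \<sigma> * a)"
    using lin_right[OF D D G, of "- \<tau>" 0] \<tau> by (simp add: \<mu>_def mult_left_mono)
  moreover have "L / 2 * (metric_norm g p \<mu>)\<^sup>2 \<le> L / 2 * (\<tau> * (a + L * \<sigma>))\<^sup>2"
    using L \<mu>n nonneg[OF \<mu>] by (intro mult_left_mono power_mono) (auto simp: metric_norm_def)
  ultimately show "f q \<le> f p - \<tau> * (a\<^sup>2 - L * \<sigma> * a) + L / 2 * (\<tau> * (a + L * \<sigma>))\<^sup>2"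
    using descent[OF p \<mu>] unfolding q' by linarith
  \<comment> \<open>The Lipschitz condition is used again, now along the actual step
    \<open>\<mu>\<close>. By isometry the gradient norm at \<open>q\<close> is the norm of
    \<open>Q\<close>, which can be compared with the gradient inside the tangent space at
    \<open>p\<close>.\<close>
  define Q where "Q = inverse_transport M T p \<mu> (grad M g f q)"
  have Q: "Q \<in> ?S" "metric_norm g p Q = metric_norm g q (grad M g f q)"
    unfolding Q_def q' using inverse_transport_isometric[OF M g R T iso p \<mu>]
      grad_properties(1)[OF M g f RM[OF \<mu>]] by blast+
  have "Q - ?G \<in> ?S" using Q(1) G subspace by (simp add: subspace_diff)
  from triangle[OF this G] have "metric_norm g p Q \<le> metric_norm g p (Q - ?G) + a"
    unfolding metric_norm_def a by simp
  also have "metric_norm g p (Q - ?G) \<le> L * metric_norm g p \<mu>"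
    using lipschitz[OF p \<mu>] unfolding Q_def q' .
  also have "\<dots> \<le> L * (\<tau> * (a + L * \<sigma>))" using \<mu>n L by simp
  finally show "metric_norm g q (grad M g f q) \<le> a + L * (\<tau> * (a + L * \<sigma>))"
    unfolding Q(2) by simp
qed

theorem theorem4p1:
  fixes M :: "(real ^ 'n) set"
    and d :: nat
    and g :: "real ^ 'n \<Rightarrow> real ^ 'n \<Rightarrow> real ^ 'n \<Rightarrow> real"
    and R :: "real ^ 'n \<Rightarrow> real ^ 'n \<Rightarrow> real ^ 'n"
    and T :: "real ^ 'n \<Rightarrow> real ^ 'n \<Rightarrow> real ^ 'n \<Rightarrow> real ^ 'n"
    and f :: "real ^ 'n \<Rightarrow> real"
    and L :: real
    and t \<rho> :: "nat \<Rightarrow> real"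
    and x :: "nat \<Rightarrow> real ^ 'n"
  assumes "embedded_submanifold d M"
    and "riemannian_metric M g"
    and "manifold_retraction M R"
    and "vector_transport M R T"
    and "isometric_transport M g R T"
    and "C_diff_on 1 M f"
    and "L > 0"
    and descent: "\<And>p \<eta>. p \<in> M \<Longrightarrow> \<eta> \<in> tangent_space M p \<Longrightarrow>
          f (R p \<eta>) \<le> f p + g p (grad M g f p) \<eta> + L / 2 * (metric_norm g p \<eta>)\<^sup>2"
    and lipschitz: "\<And>p \<eta>. p \<in> M \<Longrightarrow> \<eta> \<in> tangent_space M p \<Longrightarrow>
          metric_norm g p (inverse_transport M T p \<eta> (grad M g f (R p \<eta>)) - grad M g f p)
            \<le> L * metric_norm g p \<eta>"
    and "\<And>k. k \<ge> 1 \<Longrightarrow> t k > 0"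
    and "\<And>k. k \<ge> 1 \<Longrightarrow> \<rho> k > 0"
    and "filterlim (\<lambda>n. \<Sum>k=1..n. t k) at_top sequentially"
    and "\<And>k. k \<ge> 1 \<Longrightarrow> t (Suc k) \<le> t k"
    and "t \<longlonglongrightarrow> 0"
    and "summable (\<lambda>k. t (Suc k) * \<rho> (Suc k))"
    and "limsup (\<lambda>k. ereal (\<rho> k)) < ereal (2 / L)"
    and "rsam_sequence M g R T f t \<rho> x"
    and "\<And>k. k \<ge> 1 \<Longrightarrow> grad M g f (x k) \<noteq> 0"
    and "bdd_below ((\<lambda>k. f (x k)) ` {1..})"
  shows "((\<lambda>k. metric_norm g (x k) (grad M g f (x k))) \<longlonglongrightarrow> 0 \<and>
          (\<forall>p. accumulation_point M x p \<longrightarrow> stationary_point M g f p)) \<and>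
         (\<forall>p. accumulation_point M x p \<longrightarrow> (\<lambda>k. f (x k)) \<longlonglongrightarrow> f p)"
proof -
  define a where "a k = metric_norm g (x k) (grad M g f (x k))" for k
  have step: "x (Suc k) = R (x k) (- t k *\<^sub>R inverse_transport M T (x k)
      (rsam_direction M g f (\<rho> k) (x k)) (grad M g f (R (x k) (rsam_direction M g f (\<rho> k) (x k)))))"
    if "k \<ge> 1" for k
    using assms(17) that unfolding rsam_sequence_def Let_def by blast
  \<comment> \<open>The open premise is \<open>x k \<in> M\<close>; the first conclusion of the step
    itself supplies it by induction.\<close>
  note rsam = rsam_step[OF assms(1-6) descent lipschitz \<open>L > 0\<close> _ assms(18,10,11) refl step refl,
      folded a_def]
  have xM: "x k \<in> M" if "k \<ge> 1" for k
    using that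
  proof (induction k rule: dec_induct)
    case base
    then show ?case using assms(17) by (simp add: rsam_sequence_def)
  next
    case (step k)
    then show ?case using rsam(1)[of k] by simp
  qed
  \<comment> \<open>A number strictly between the limsup and \<open>2 / L\<close> bounds \<rho>
    eventually while leaving a positive margin.\<close>
  obtain r where "limsup (\<lambda>k. ereal (\<rho> k)) < ereal r" "ereal r < ereal (2 / L)"
    using ereal_dense2[OF assms(16)] by (elim exE conjE)
  then have r: "r < 2 / L" "eventually (\<lambda>k. \<rho> k \<le> r) sequentially"
    by (auto dest!: Limsup_lessD elim: eventually_mono)
  define \<epsilon> where "\<epsilon> = (1 - L * r / 2) / 2"
  have "\<epsilon> > 0" using r(1) \<open>L > 0\<close> by (simp add: \<epsilon>_def field_simps)
  have "eventually (\<lambda>k. t k < 1) sequentially" "eventually (\<lambda>k. t k < \<epsilon> / L) sequentially"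
    using order_tendstoD(2)[OF assms(14)] \<open>\<epsilon> > 0\<close> \<open>L > 0\<close> by auto
  with r(2) have "eventually (\<lambda>k. \<rho> k \<le> r \<and> t k \<le> 1 \<and> L * t k \<le> \<epsilon>) sequentially"
    by eventually_elim (use \<open>L > 0\<close> in \<open>auto simp: field_simps\<close>)
  then obtain N' where N': "\<And>k. k \<ge> N' \<Longrightarrow> \<rho> k \<le> r \<and> t k \<le> 1 \<and> L * t k \<le> \<epsilon>"
    unfolding eventually_sequentially by blast
  \<comment> \<open>The scalar lemma needs its bounds at every index, so it is applied to the tail
    from \<open>N\<close>. The successor ensures \<open>N \<ge> 1\<close>, as nothing is assumed
    about the data at index \<open>0\<close>.\<close>
  define N where "N = Suc N'"
  obtain m where m: "\<And>k. k \<ge> 1 \<Longrightarrow> m \<le> f (x k)"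
    using assms(19) unfolding bdd_below_def by auto
  have nsum: "\<not> summable t"
  proof
    assume "summable t"
    then have "summable (\<lambda>k. t (Suc k))" by (simp add: summable_Suc_iff)
    then have "(\<lambda>n. \<Sum>k=1..n. t k) \<longlonglongrightarrow> (\<Sum>k. t (Suc k))"
      using summable_LIMSEQ by (simp add: sum.atLeast1_atMost_eq)
    then show False
      using not_tendsto_and_filterlim_at_infinity[OF sequentially_bot]
        filterlim_at_top_imp_at_infinity[OF assms(12)] by blast
  qed
  have "summable (\<lambda>k. t k * \<rho> k)" using assms(15) by (subst (asm) summable_Suc_iff)
  then have sum: "summable (\<lambda>k. t (k + N) * \<rho> (k + N))"
    by (rule summable_ignore_initial_segment)
  have nsum': "\<not> summable (\<lambda>k. t (k + N))" using nsum summable_iff_shift by blast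
  have N1: "k + N \<ge> 1" for k by (simp add: N_def)
  have "0 \<le> a (k + N)" for k
    using grad_properties(1)[OF assms(1,2,6) xM[OF N1]]
      inner_on.nonneg[OF tangent_inner_on[OF assms(1,2) xM[OF N1]]]
    by (simp add: a_def metric_norm_def)
  moreover have "0 < t (k + N)" "0 < \<rho> (k + N)" "m \<le> f (x (k + N))" for k
    using assms(10,11) m N1 by auto
  moreover have "f (x (Suc k + N)) \<le> f (x (k + N))
      - t (k + N) * ((a (k + N))\<^sup>2 - L * \<rho> (k + N) * a (k + N))
      + L / 2 * (t (k + N) * (a (k + N) + L * \<rho> (k + N)))\<^sup>2"
    "a (Suc k + N) \<le> a (k + N) + L * (t (k + N) * (a (k + N) + L * \<rho> (k + N)))" for k
    using rsam(2,3)[of "k + N"] xM[OF N1[of k]] N1[of k] by simp_all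
  moreover have "\<rho> (k + N) \<le> r" "t (k + N) \<le> 1" "L * t (k + N) \<le> (1 - L * r / 2) / 2" for k
    using N'[of "k + N"] by (auto simp: N_def \<epsilon>_def)
  ultimately have "(\<lambda>k. a (k + N)) \<longlonglongrightarrow> 0" "convergent (\<lambda>k. f (x (k + N)))"
    using perturbed_descent_convergence[of L "\<lambda>k. a (k + N)" "\<lambda>k. t (k + N)" "\<lambda>k. \<rho> (k + N)"
        "\<lambda>k. f (x (k + N))" m r] \<open>L > 0\<close> r(1) sum nsum' by blast+
  then have a0: "a \<longlonglongrightarrow> 0" and "convergent (\<lambda>k. f (x k))"
    using convergent_ignore_initial_segment[of "\<lambda>k. f (x k)" N] by (auto dest: LIMSEQ_offset)
  then obtain l where l: "(\<lambda>k. f (x k)) \<longlonglongrightarrow> l" unfolding convergent_def by blast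
  have "stationary_point M g f p \<and> (\<lambda>k. f (x k)) \<longlonglongrightarrow> f p" if acc: "accumulation_point M x p" for p
  proof -
    obtain s where p: "p \<in> M" and s: "strict_mono s" "(x \<circ> s) \<longlonglongrightarrow> p"
      using acc unfolding accumulation_point_def by blast
    \<comment> \<open>The subsequence may start at index \<open>0\<close>, where \<open>x 0\<close>
      is arbitrary; dropping its first term puts all points in \<open>M\<close>.\<close>
    define y where "y n = s (Suc n)" for n
    have y: "strict_mono y" using s(1) by (simp add: y_def strict_mono_def)
    have y1: "y n \<ge> 1" for n
      using strict_mono_imp_increasing[OF s(1), of "Suc n"] by (simp add: y_def)
    have lim: "(\<lambda>n. x (y n)) \<longlonglongrightarrow> p" using LIMSEQ_Suc[OF s(2)] by (simp add: y_def o_def)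
    have "(\<lambda>n. a (y n)) \<longlonglongrightarrow> 0" using LIMSEQ_subseq_LIMSEQ[OF a0 y] by (simp add: o_def)
    then have "grad M g f p = 0"
      using stationary_limit[OF assms(1,2,6) p lim] xM y1 by (simp add: a_def)
    moreover have "(\<lambda>n. f (x (y n))) \<longlonglongrightarrow> f p"
      using C_diff_on_tendsto[OF assms(6) p lim] xM y1 by simp
    \<comment> \<open>The whole sequence of values already converges to \<open>l\<close>, so a
      single subsequence identifies the limit.\<close>
    then have "l = f p"
      using LIMSEQ_subseq_LIMSEQ[OF l y] LIMSEQ_unique by (fastforce simp: o_def)
    ultimately show ?thesis using l p by (simp add: stationary_point_def)
  qed
  then show ?thesis using a0 by (simp add: a_def[abs_def])
qed

end
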